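(* Let $n\ge1$ be an integer. The set $\mathcal{IC}(\mathbf{A}_{n-1})$ of interval-closed sets of $\mathbf{A}_{n-1}$ is in bijection with the set of lattice walks in the first quadrant $\{(x,y):x,y\ge0\}$ starting and ending at the origin, and consisting of $2n$ steps from the set $\{\mathtt{e},\mathtt{w},\mathtt{se},\mathtt{nw}\}$, where no $\mathtt{w}$ step on the $x$-axis is immediately followed by an $\mathtt{e}$ step.
   Context: For a finite poset $P$, a subset $I\subseteq P$ is an interval-closed set if for all $a,b\in I$ and $z\in P$ with $a<z<b$ we have $z\in I$; $\mathcal{IC}(P)$ is the set of all interval-closed sets of $P$ (including the empty set). $\mathbf{A}_k$ is the poset of positive roots of type $A_k$ (the triangular poset with $k$ minimal elements): its elements are the intervals $[i,j]$ with $1\le i\le j\le k$, ordered by inclusion. Equivalently it is the poset obtained from $[k]\times[k]$ (componentwise order) by removing the bottom $k-1$ ranks. $\mathbf{A}_0$ is empty. The steps are $\mathtt{e}=(1,0)$, $\mathtt{w}=(-1,0)$, $\mathtt{se}=(1,-1)$, $\mathtt{nw}=(-1,1)$. Walks must stay in the first quadrant at all times. *)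

theory Defs
  imports Main "HOL-Library.Product_Plus"
begin

text \<open>The poset is a set \<open>P\<close> of elements of an ordered type, with the induced order.\<close>

definition interval_closed_sets :: "'a::order set \<Rightarrow> 'a set set" where
  "interval_closed_sets P =
     {I. I \<subseteq> P \<and> (\<forall>a\<in>I. \<forall>b\<in>I. \<forall>z\<in>P. a < z \<and> z < b \<longrightarrow> z \<in> I)}"

text \<open>The positive roots of type \<open>A\<^sub>k\<close> are the integer intervals \<open>[i, j]\<close> themselves, so that
  the order of the type \<^typ>\<open>nat set\<close> is the inclusion order of the root poset.\<close>

definition root_poset_A :: "nat \<Rightarrow> nat set set" where
  "root_poset_A k = {{i..j} | i j. 1 \<le> i \<and> i \<le> j \<and> j \<le> k}"

abbreviation step_e :: "int \<times> int" where "step_e \<equiv> (1, 0)"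
abbreviation step_w :: "int \<times> int" where "step_w \<equiv> (-1, 0)"
abbreviation step_se :: "int \<times> int" where "step_se \<equiv> (1, -1)"
abbreviation step_nw :: "int \<times> int" where "step_nw \<equiv> (-1, 1)"

text \<open>A walk starting at the origin is the list of its steps; \<open>walk_pos s k\<close> is its position after
  the first \<open>k\<close> steps, i.e. the starting point of the step \<open>s ! k\<close>.\<close>

definition walk_pos :: "(int \<times> int) list \<Rightarrow> nat \<Rightarrow> int \<times> int" where
  "walk_pos s k = sum_list (take k s)"

definition in_first_quadrant :: "(int \<times> int) list \<Rightarrow> bool" where
  "in_first_quadrant s \<longleftrightarrow>
     (\<forall>k\<le>length s. 0 \<le> fst (walk_pos s k) \<and> 0 \<le> snd (walk_pos s k))"

text \<open>A \<open>w\<close> step preserves the second coordinate, so it lies on the \<open>x\<close>-axis iff it starts there.\<close>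

definition has_we_on_x_axis :: "(int \<times> int) list \<Rightarrow> bool" where
  "has_we_on_x_axis s \<longleftrightarrow>
     (\<exists>k. Suc k < length s \<and> s ! k = step_w \<and> s ! Suc k = step_e \<and> snd (walk_pos s k) = 0)"

definition quadrant_walks :: "nat \<Rightarrow> (int \<times> int) list set" where
  "quadrant_walks m =
     {s. length s = m \<and> set s \<subseteq> {step_e, step_w, step_se, step_nw} \<and>
         in_first_quadrant s \<and> walk_pos s m = (0, 0) \<and> \<not> has_we_on_x_axis s}"

end

theory Submission imports Defs begin

text \<open>
  Draw the root \<open>[i, j]\<close> as the diamond with bottom vertex \<open>(i + j, j - i)\<close> and top vertex
  \<open>(i + j, j - i + 2)\<close>. The order ideals of \<open>A\<^sub>n\<^sub>-\<^sub>1\<close> are then the sets of diamonds that lie under a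
  Dyck path of length \<open>2n\<close>, one path for each ideal (\<open>below_mono_imp_le\<close> and
  \<open>down_closed_eq_below\<close>). A quadrant walk is a pair of nested Dyck paths: at the position
  \<open>(x, y)\<close> the lower path has height \<open>x\<close> and the upper one height \<open>x + 2 * y\<close>, so \<open>e\<close> and \<open>w\<close>
  move both paths in parallel, up and down respectively, while \<open>se\<close> and \<open>nw\<close> move them towards and
  away from each other. The walk is sent to the set of diamonds between its two paths, which is a
  difference \<open>U - L\<close> of two ideals \<open>L \<subseteq> U\<close> and hence interval-closed.

  Every interval-closed set \<open>I\<close> is such a difference, but in general of several pairs. Among them
  there is a largest one, in which \<open>L\<close> consists of all roots that are weakly above no element of
  \<open>I\<close>, and \<open>U = L \<union> I\<close>. If \<open>(L, U)\<close> is not the largest pair, take a minimal root \<open>z\<close> among those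
  outside \<open>L\<close> and weakly above no element of \<open>I\<close>. It can be added to both ideals, because
  everything strictly below \<open>z\<close> is in \<open>L\<close>, and both paths have a valley at the bottom vertex of
  \<open>z\<close>. Conversely, a valley common to both paths is the bottom vertex of a root that can be added to
  both ideals. So the largest pairs are exactly the pairs without a common valley (\<open>no_common_valley_iff\<close>). In terms of the walk, a
  common valley is a \<open>w\<close> step on the \<open>x\<close>-axis followed by an \<open>e\<close> step, and the walks
  without such a pattern correspond to the interval-closed sets one to one.
\<close>

section \<open>Dyck paths as height functions\<close>

definition dyck_height :: "nat \<Rightarrow> (nat \<Rightarrow> int) \<Rightarrow> bool" where
  "dyck_height n h \<longleftrightarrow> h 0 = 0 \<and> h (2 * n) = 0 \<and> (\<forall>t\<le>2 * n. 0 \<le> h t) \<and>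
     (\<forall>t<2 * n. h (Suc t) = h t + 1 \<or> h (Suc t) = h t - 1)"

lemma dyck_height_step:
  "dyck_height n h \<Longrightarrow> t < 2 * n \<Longrightarrow> h (Suc t) = h t + 1 \<or> h (Suc t) = h t - 1"
  by (simp add: dyck_height_def)

lemma dyck_height_nonneg: "dyck_height n h \<Longrightarrow> t \<le> 2 * n \<Longrightarrow> 0 \<le> h t"
  by (simp add: dyck_height_def)

lemma dyck_height_lipschitz:
  assumes "dyck_height n h" "s \<le> t" "t \<le> 2 * n"
  shows "\<bar>h t - h s\<bar> \<le> int t - int s"
  using assms(2,3)
proof (induction t rule: dec_induct)
  case base
  show ?case by simp
next
  case (step t)
  then show ?case using dyck_height_step[OF assms(1), of t] by auto
qed

lemma dyck_height_parity:
  assumes "dyck_height n h" "t \<le> 2 * n"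
  shows "even (h t + int t)"
  using assms(2)
proof (induction t)
  case 0
  show ?case using assms(1) by (simp add: dyck_height_def)
next
  case (Suc t)
  then show ?case using dyck_height_step[OF assms(1), of t] by auto
qed

lemma dyck_height_bounds:
  assumes "dyck_height n h" "t \<le> 2 * n"
  shows "h t \<le> int t" "h t \<le> 2 * int n - int t"
  using dyck_height_lipschitz[OF assms(1), of 0 t] dyck_height_lipschitz[OF assms(1), of t "2 * n"] assms
  by (auto simp: dyck_height_def)

section \<open>Order ideals of the root poset\<close>

text \<open>The diamond of \<open>[i, j]\<close> lies under the path iff its top vertex does, \<open>j - i + 2 \<le> h (i + j)\<close>;
  by parity this amounts to the strict inequality below.\<close>

definition below :: "nat \<Rightarrow> (nat \<Rightarrow> int) \<Rightarrow> nat set set" where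
  "below n h = {{i..j} | i j. 1 \<le> i \<and> i \<le> j \<and> j < n \<and> int j - int i < h (i + j)}"

lemma root_poset_A_iff:
  assumes "n \<ge> 1"
  shows "z \<in> root_poset_A (n - 1) \<longleftrightarrow> (\<exists>i j. z = {i..j} \<and> 1 \<le> i \<and> i \<le> j \<and> j < n)"
  using assms unfolding root_poset_A_def by fastforce

lemma atLeastAtMost_mem_below_iff:
  fixes i j :: nat
  assumes "1 \<le> i" "i \<le> j" "j < n"
  shows "{i..j} \<in> below n h \<longleftrightarrow> int j - int i < h (i + j)"
  using assms unfolding below_def by (auto simp: Icc_eq_Icc)

lemma below_subset:
  assumes "n \<ge> 1"
  shows "below n h \<subseteq> root_poset_A (n - 1)"
  unfolding below_def root_poset_A_iff[OF assms] subset_iff by blast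

text \<open>A path changes its height by at most one in each step, whereas an interval of length \<open>j - i\<close>
  at position \<open>i + j\<close> gets shorter by exactly one whenever it loses an endpoint, which moves it by
  one position.\<close>

lemma below_down_closed:
  assumes h: "dyck_height n h" and b: "b \<in> below n h"
    and a: "a \<in> root_poset_A (n - 1)" and n: "n \<ge> 1" and ab: "a \<subseteq> b"
  shows "a \<in> below n h"
proof -
  obtain i j where ij: "b = {i..j}" "1 \<le> i" "i \<le> j" "j < n" "int j - int i < h (i + j)"
    using b by (auto simp: below_def)
  obtain i' j' where ij': "a = {i'..j'}" "1 \<le> i'" "i' \<le> j'" "j' < n"
    using a unfolding root_poset_A_iff[OF n] by blast
  have le: "i \<le> i'" "j' \<le> j" using ab ij ij' by (auto simp: ij(1) ij'(1))
  have "int j' - int i' < h (i' + j')"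
  proof (cases "i + j \<le> i' + j'")
    case True
    then show ?thesis using dyck_height_lipschitz[OF h True] ij ij' le by auto
  next
    case False
    then show ?thesis using dyck_height_lipschitz[OF h, of "i' + j'" "i + j"] ij ij' le by auto
  qed
  then show ?thesis using ij' by (auto simp: atLeastAtMost_mem_below_iff)
qed

text \<open>If \<open>h\<close> exceeds \<open>g\<close> somewhere, it does so by at least two, by parity. Each vertex of height at
  least two on a path is the top vertex of a root, because the bounds on the height keep the
  endpoints of the corresponding interval between \<open>1\<close> and \<open>n - 1\<close>; the root with top vertex
  \<open>(t, h t)\<close> lies under \<open>h\<close> only. In particular, a path is determined by its ideal.\<close>

lemma below_mono_imp_le:
  assumes h: "dyck_height n h" and g: "dyck_height n g"
    and sub: "below n h \<subseteq> below n g" and t: "t \<le> 2 * n"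
  shows "h t \<le> g t"
proof (rule ccontr)
  assume "\<not> h t \<le> g t"
  moreover have "even (h t + int t)" "even (g t + int t)"
    using h g t dyck_height_parity by blast+
  ultimately have lt: "g t + 2 \<le> h t"
    by presburger
  have g0: "0 \<le> g t" using g t dyck_height_nonneg by blast
  note b = dyck_height_bounds[OF h t]
  \<comment> \<open>The root with top vertex \<open>(t, h t)\<close>.\<close>
  define i where "i = nat ((int t - h t + 2) div 2)"
  define j where "j = nat ((int t + h t - 2) div 2)"
  have "even (int t - h t + 2)" "even (int t + h t - 2)"
    using \<open>even (h t + int t)\<close> by presburger+
  then have i: "2 * int i = int t - h t + 2" and j: "2 * int j = int t + h t - 2"
    using b lt g0 unfolding i_def j_def by simp_all
  have "1 \<le> i" "i \<le> j" "j < n" "i + j = t" "int j - int i = h t - 2"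
    using i j b lt g0 by linarith+
  then show False
    using sub atLeastAtMost_mem_below_iff[of i j n h] atLeastAtMost_mem_below_iff[of i j n g] lt by auto
qed

text \<open>The path of an ideal is the upper envelope of the tents \<open>\<lambda>t. j - i + 2 - \<bar>t - (i + j)\<bar>\<close> over
  its roots \<open>[i, j]\<close>: the tent of a root has its peak at the top vertex of the diamond. The
  degenerate intervals \<open>[i, i - 1]\<close> add the zigzag path of the empty ideal. An envelope of
  functions that change by at most one per step changes by at most one, and it changes at all
  because the value of each tent at \<open>t\<close> has the parity of \<open>t\<close>. A root whose top vertex is under the tent of \<open>[i, j]\<close> is
  contained in \<open>[i, j]\<close>, so the envelope creates no new roots.\<close>

lemma down_closed_eq_below:
  assumes n: "n \<ge> 1" and JP: "J \<subseteq> root_poset_A (n - 1)"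
    and down: "\<And>a b. b \<in> J \<Longrightarrow> a \<in> root_poset_A (n - 1) \<Longrightarrow> a \<subseteq> b \<Longrightarrow> a \<in> J"
  shows "\<exists>h. dyck_height n h \<and> J = below n h"
proof -
  define K where "K = {(i, j). 1 \<le> i \<and> i \<le> j + 1 \<and> j < n \<and> (i \<le> j \<longrightarrow> {i..j} \<in> J)}"
  define v where "v = (\<lambda>t (i::nat, j::nat). int j - int i + 2 - \<bar>int t - int i - int j\<bar>)"
  define h where "h t = Max (v t ` K)" for t
  have "K \<subseteq> {..n} \<times> {..n}" by (auto simp: K_def)
  then have fin: "finite K" using finite_subset by blast
  have Kdeg: "(Suc i, i) \<in> K" if "i < n" for i using that by (auto simp: K_def)
  have ne: "K \<noteq> {}" using Kdeg[of 0] n by auto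
  have ge: "v t k \<le> h t" if "k \<in> K" for t k
    unfolding h_def using that fin by simp
  have attained: "\<exists>k\<in>K. h t = v t k" for t
  proof -
    have "h t \<in> v t ` K" unfolding h_def by (rule Max_in) (use fin ne in auto)
    then show ?thesis by blast
  qed
  have vpar: "even (v t k + int t)" for t k
    by (cases k) (auto simp: v_def abs_if)
  have vlip: "\<bar>v (Suc t) k - v t k\<bar> \<le> 1" for t k
    by (cases k) (auto simp: v_def)
  have step: "h (Suc t) = h t + 1 \<or> h (Suc t) = h t - 1" for t
  proof -
    obtain k where k: "k \<in> K" "h t = v t k" using attained by blast
    obtain k' where k': "k' \<in> K" "h (Suc t) = v (Suc t) k'" using attained by blast
    have "\<bar>h (Suc t) - h t\<bar> \<le> 1"
      using ge[OF k(1), of "Suc t"] ge[OF k'(1), of t] vlip[of t k] vlip[of t k'] k k' by linarith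
    moreover have "h (Suc t) \<noteq> h t"
      using vpar[of t k] vpar[of "Suc t" k'] k k' by auto
    ultimately show ?thesis by linarith
  qed
  have nonneg: "0 \<le> h t" if t: "t \<le> 2 * n" for t
  proof -
    \<comment> \<open>A degenerate tent that is nonnegative at \<open>t\<close>; at the right end, only the last one is.\<close>
    define m where "m = (if t = 2 * n then n - 1 else t div 2)"
    have "m < n" using t n by (auto simp: m_def)
    moreover have "0 \<le> v t (Suc m, m)"
      using n t by (cases "even t") (auto simp: v_def m_def elim!: evenE oddE)
    ultimately show ?thesis using ge[OF Kdeg, of m t] by linarith
  qed
  have le0: "h 0 \<le> 0"
    using attained[of 0] by (auto simp: v_def K_def)
  have le1: "h (2 * n) \<le> 0"
    using attained[of "2 * n"] by (auto simp: v_def K_def)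
  have "h 0 = 0" "h (2 * n) = 0"
    using nonneg[of 0] nonneg[of "2 * n"] le0 le1 by linarith+
  then have dyck: "dyck_height n h"
    unfolding dyck_height_def using step nonneg by blast
  have mem: "{i..j} \<in> J \<longleftrightarrow> int j - int i < h (i + j)" if ij: "1 \<le> i" "i \<le> j" "j < n" for i j
  proof
    assume "{i..j} \<in> J"
    then have "(i, j) \<in> K" using ij by (auto simp: K_def)
    then show "int j - int i < h (i + j)" using ge[of "(i, j)" "i + j"] by (auto simp: v_def)
  next
    assume lt: "int j - int i < h (i + j)"
    obtain i' j' where k: "(i', j') \<in> K" "h (i + j) = v (i + j) (i', j')"
      using attained[of "i + j"] by auto
    have "int j - int i + 2 \<le> v (i + j) (i', j')"
      using lt vpar[of "i + j" "(i', j')"] unfolding k(2) by presburger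
    then have le: "i' \<le> i" "j \<le> j'" by (auto simp: v_def)
    then have "{i'..j'} \<in> J" using k(1) ij by (auto simp: K_def)
    moreover have "{i..j} \<in> root_poset_A (n - 1)" using ij unfolding root_poset_A_iff[OF n] by blast
    ultimately show "{i..j} \<in> J" using down[of "{i'..j'}" "{i..j}"] le by auto
  qed
  have "z \<in> J \<longleftrightarrow> z \<in> below n h" if z: "z \<in> root_poset_A (n - 1)" for z
  proof -
    obtain i j where "z = {i..j}" "1 \<le> i" "i \<le> j" "j < n"
      using z unfolding root_poset_A_iff[OF n] by blast
    then show ?thesis using mem by (simp add: atLeastAtMost_mem_below_iff)
  qed
  then have "J = below n h" using JP below_subset[OF n, of h] by blast
  with dyck show ?thesis by blast
qed

section \<open>The largest pair of ideals with a given difference\<close>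

definition not_above :: "nat \<Rightarrow> nat set set \<Rightarrow> nat set set" where
  "not_above n I = {z \<in> root_poset_A (n - 1). \<not> (\<exists>a\<in>I. a \<subseteq> z)}"

definition common_valley :: "nat \<Rightarrow> (nat \<Rightarrow> int) \<Rightarrow> (nat \<Rightarrow> int) \<Rightarrow> bool" where
  "common_valley n l u \<longleftrightarrow> (\<exists>k. Suc k < 2 * n \<and> l k = u k \<and> l (Suc k) = u (Suc k) \<and>
     l (Suc (Suc k)) = u (Suc (Suc k)) \<and> l (Suc k) = l k - 1 \<and> l (Suc (Suc k)) = l k)"

text \<open>Descend from \<open>[i, j]\<close> through roots outside the lower ideal. The descent can only stop at a root
  that has lost both lower neighbours \<open>[i, j - 1]\<close> and \<open>[i + 1, j]\<close> to the lower ideal, or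
  is minimal and has none. If such a root is outside the upper ideal as well, the two paths both
  run through its bottom vertex and have a valley there.\<close>

lemma ex_subset_between_paths:
  assumes l: "dyck_height n l" and u: "dyck_height n u"
    and lu: "\<And>t. t \<le> 2 * n \<Longrightarrow> l t \<le> u t"
    and nv: "\<not> common_valley n l u"
    and "1 \<le> i" "i \<le> j" "j < n" "l (i + j) \<le> int j - int i"
  shows "\<exists>a\<in>below n u - below n l. a \<subseteq> {i..j}"
  using assms(5-)
proof (induction "j - i" arbitrary: i j rule: less_induct)
  case less
  note ij = less.prems
  define k where "k = i + j - 1"
  have k: "i + j = Suc k" "Suc k < 2 * n" using ij by (auto simp: k_def)
  show ?case
  proof (cases "int j - int i < u (i + j)")
    case True
    then have "{i..j} \<in> below n u - below n l" using ij by (auto simp: atLeastAtMost_mem_below_iff)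
    then show ?thesis by blast
  next
    case notu: False
    \<comment> \<open>Heights are nonnegative, so a minimal root \<open>[i, i]\<close> falls under the last case.\<close>
    consider (left) "i < j" "l k \<le> int j - int i - 1"
      | (right) "i < j" "l (Suc (Suc k)) \<le> int j - int i - 1"
      | (stop) "int j - int i - 1 < l k" "int j - int i - 1 < l (Suc (Suc k))"
      using dyck_height_nonneg[OF l, of k] dyck_height_nonneg[OF l, of "Suc (Suc k)"] k ij
      by (cases "i < j") force+
    then show ?thesis
    proof cases
      case left
      have "\<exists>a\<in>below n u - below n l. a \<subseteq> {i..j - 1}"
        by (rule less.hyps) (use left ij k_def in auto)
      moreover have "{i..j - 1} \<subseteq> {i..j}" by auto
      ultimately show ?thesis by blast
    next
      case right
      have "\<exists>a\<in>below n u - below n l. a \<subseteq> {Suc i..j}"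
        by (rule less.hyps) (use right ij k in auto)
      moreover have "{Suc i..j} \<subseteq> {i..j}" by auto
      ultimately show ?thesis by blast
    next
      case stop
      have p: "even (l k + int k)"
        using dyck_height_parity[OF l, of k] k by auto
      have ki: "int k = int i + int j - 1" using k by linarith
      have low: "l (Suc k) = int j - int i" "l k = int j - int i + 1"
        "l (Suc (Suc k)) = int j - int i + 1"
        using stop p ki ij(4) dyck_height_step[OF l, of k] dyck_height_step[OF l, of "Suc k"] k
        by (auto, presburger+)
      have up: "u (Suc k) = int j - int i" "u k = int j - int i + 1"
        "u (Suc (Suc k)) = int j - int i + 1"
        using low notu lu[of k] lu[of "Suc k"] lu[of "Suc (Suc k)"] k
          dyck_height_step[OF u, of k] dyck_height_step[OF u, of "Suc k"] by auto
      have "common_valley n l u"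
        unfolding common_valley_def using low up k(2) by (intro exI[of _ k]) auto
      then show ?thesis using nv by blast
    qed
  qed
qed

text \<open>The root \<open>z\<close> whose bottom vertex is a common valley lies outside both ideals. The roots covered by
  \<open>z\<close> lie in the lower ideal, so no element of the difference can be contained in \<open>z\<close>.\<close>

lemma common_valley_imp:
  assumes n: "n \<ge> 1" and l: "dyck_height n l" and cv: "common_valley n l u"
  shows "\<exists>z. z \<in> not_above n (below n u - below n l) \<and> z \<notin> below n l"
proof -
  obtain k where k: "Suc k < 2 * n" "l k = u k" "l (Suc k) = u (Suc k)"
     "l (Suc (Suc k)) = u (Suc (Suc k))" "l (Suc k) = l k - 1" "l (Suc (Suc k)) = l k"
    using cv unfolding common_valley_def by blast
  define d where "d = l (Suc k)"
  have d0: "0 \<le> d" using dyck_height_nonneg[OF l, of "Suc k"] k by (simp add: d_def)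
  have dk: "l k = d + 1" using k by (simp add: d_def)
  have d1: "d + 1 \<le> int k" and d2: "d + 1 \<le> 2 * int n - int k - 2"
    using dyck_height_bounds[OF l, of k] dyck_height_bounds[OF l, of "Suc (Suc k)"] k dk by auto
  have p: "even (d + 1 + int k)" using dyck_height_parity[OF l, of k] k dk by auto
  \<comment> \<open>The root with bottom vertex \<open>(k + 1, d)\<close>.\<close>
  define i where "i = nat ((int k + 1 - d) div 2)"
  define j where "j = nat ((int k + 1 + d) div 2)"
  have "even (int k + 1 - d)" "even (int k + 1 + d)"
    using p by presburger+
  then have i: "2 * int i = int k + 1 - d" and j: "2 * int j = int k + 1 + d"
    using d0 d1 unfolding i_def j_def by simp_all
  have ij: "1 \<le> i" "i \<le> j" "j < n" "i + j = Suc k" "int j - int i = d"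
    using i j d0 d1 d2 by linarith+
  have P: "{i..j} \<in> root_poset_A (n - 1)" using ij unfolding root_poset_A_iff[OF n] by blast
  have nl: "{i..j} \<notin> below n l" "{i..j} \<notin> below n u"
    using ij k(3) by (auto simp: atLeastAtMost_mem_below_iff d_def)
  have False if a: "a \<in> below n u" "a \<notin> below n l" "a \<subseteq> {i..j}" for a
  proof -
    have aP: "a \<in> root_poset_A (n - 1)" using a(1) below_subset[OF n] by blast
    then obtain i' j' where a': "a = {i'..j'}" "1 \<le> i'" "i' \<le> j'" "j' < n"
      unfolding root_poset_A_iff[OF n] by blast
    have le: "i \<le> i'" "j' \<le> j" using a(3) a' by auto
    have "a \<noteq> {i..j}" using a(1) nl by blast
    then consider "Suc i \<le> i'" | "j' \<le> j - 1" "i < j" using le a' by fastforce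
    then show False
    proof cases
      case 1
      then have "a \<subseteq> {Suc i..j}" using le a' by auto
      moreover have "{Suc i..j} \<in> below n l"
        using 1 ij a' le k(6) dk by (subst atLeastAtMost_mem_below_iff) auto
      ultimately show False using below_down_closed[OF l _ aP n] a(2) by blast
    next
      case 2
      then have "a \<subseteq> {i..j - 1}" using le a' by auto
      moreover have "i + (j - 1) = k" using 2 ij by linarith
      then have "{i..j - 1} \<in> below n l"
        using 2 ij a' le dk by (subst atLeastAtMost_mem_below_iff) auto
      ultimately show False using below_down_closed[OF l _ aP n] a(2) by blast
    qed
  qed
  then have "{i..j} \<in> not_above n (below n u - below n l)"
    using P by (auto simp: not_above_def)
  then show ?thesis using nl by blast
qed

lemma no_common_valley_iff:
  assumes n: "n \<ge> 1" and l: "dyck_height n l" and u: "dyck_height n u"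
    and lu: "\<And>t. t \<le> 2 * n \<Longrightarrow> l t \<le> u t"
  shows "\<not> common_valley n l u \<longleftrightarrow> below n l = not_above n (below n u - below n l)"
proof
  assume nv: "\<not> common_valley n l u"
  have "z \<in> below n l \<longleftrightarrow> \<not> (\<exists>a\<in>below n u - below n l. a \<subseteq> z)"
    if z: "z \<in> root_poset_A (n - 1)" for z
  proof
    assume "z \<in> below n l"
    then show "\<not> (\<exists>a\<in>below n u - below n l. a \<subseteq> z)"
      using below_down_closed[OF l _ _ n] below_subset[OF n] by blast
  next
    assume no: "\<not> (\<exists>a\<in>below n u - below n l. a \<subseteq> z)"
    obtain i j where ij: "z = {i..j}" "1 \<le> i" "i \<le> j" "j < n"
      using z unfolding root_poset_A_iff[OF n] by blast
    then have "int j - int i < l (i + j)"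
      using ex_subset_between_paths[OF l u lu nv ij(2-4)] no by force
    then show "z \<in> below n l" using ij by (auto simp: atLeastAtMost_mem_below_iff)
  qed
  then show "below n l = not_above n (below n u - below n l)"
    using below_subset[OF n, of l] unfolding not_above_def by blast
next
  assume "below n l = not_above n (below n u - below n l)"
  then show "\<not> common_valley n l u" using common_valley_imp[OF n l] by blast
qed

text \<open>The paths are those of the largest pair of ideals. Its upper member is closed downwards because
  a root below an element of \<open>I\<close> is either weakly above no element of \<open>I\<close>, and so in the lower
  ideal, or between two elements of \<open>I\<close>, and so in \<open>I\<close>.\<close>

lemma interval_closed_ex_paths:
  assumes n: "n \<ge> 1" and I: "I \<in> interval_closed_sets (root_poset_A (n - 1))"
  shows "\<exists>l u. dyck_height n l \<and> dyck_height n u \<and> (\<forall>t\<le>2 * n. l t \<le> u t) \<and>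
    \<not> common_valley n l u \<and> below n u - below n l = I"
proof -
  let ?P = "root_poset_A (n - 1)"
  have IP: "I \<subseteq> ?P" and conv: "\<And>a b z. a \<in> I \<Longrightarrow> b \<in> I \<Longrightarrow> z \<in> ?P \<Longrightarrow> a \<subset> z \<Longrightarrow> z \<subset> b \<Longrightarrow> z \<in> I"
    using I unfolding interval_closed_sets_def by blast+
  let ?L = "not_above n I"
  obtain l where l: "dyck_height n l" "?L = below n l"
    using down_closed_eq_below[OF n, of ?L] unfolding not_above_def by blast
  have down: "a \<in> ?L \<union> I" if ab: "b \<in> ?L \<union> I" "a \<in> ?P" "a \<subseteq> b" for a b
  proof (rule ccontr)
    assume a: "a \<notin> ?L \<union> I"
    then obtain c where c: "c \<in> I" "c \<subseteq> a" using ab unfolding not_above_def by blast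
    then have "b \<in> I" using ab unfolding not_above_def by blast
    then show False using conv[of c b a] c a ab by blast
  qed
  have "?L \<union> I \<subseteq> ?P" using IP by (auto simp: not_above_def)
  then obtain u where u: "dyck_height n u" "?L \<union> I = below n u"
    using down_closed_eq_below[OF n, of "?L \<union> I"] down by blast
  have lu: "l t \<le> u t" if "t \<le> 2 * n" for t
    using below_mono_imp_le[OF l(1) u(1) _ that] l(2) u(2) by blast
  have diff: "below n u - below n l = I"
    unfolding l(2)[symmetric] u(2)[symmetric] by (auto simp: not_above_def)
  have "\<not> common_valley n l u"
    using no_common_valley_iff[OF n l(1) u(1) lu] diff l(2) by simp
  then show ?thesis using l u lu diff by blast
qed

section \<open>Quadrant walks as pairs of nested Dyck paths\<close>

definition lower_height :: "(int \<times> int) list \<Rightarrow> nat \<Rightarrow> int" where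
  "lower_height s t = fst (walk_pos s t)"

definition upper_height :: "(int \<times> int) list \<Rightarrow> nat \<Rightarrow> int" where
  "upper_height s t = fst (walk_pos s t) + 2 * snd (walk_pos s t)"

lemma walk_pos_0: "walk_pos s 0 = (0, 0)"
  by (simp add: walk_pos_def zero_prod_def)

lemma walk_pos_Suc: "k < length s \<Longrightarrow> walk_pos s (Suc k) = walk_pos s k + s ! k"
  by (simp add: walk_pos_def take_Suc_conv_app_nth)

lemma step_eq: "k < length s \<Longrightarrow> s ! k = walk_pos s (Suc k) - walk_pos s k"
  by (simp add: walk_pos_Suc)

lemma walk_step_cases:
  assumes "s \<in> quadrant_walks m" "k < m"
  shows "s ! k \<in> {step_e, step_w, step_se, step_nw}"
  using assms nth_mem[of k s] unfolding quadrant_walks_def by blast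

lemma quadrant_walk_heights:
  assumes s: "s \<in> quadrant_walks (2 * n)"
  shows "dyck_height n (lower_height s)" "dyck_height n (upper_height s)"
    "\<And>t. t \<le> 2 * n \<Longrightarrow> lower_height s t \<le> upper_height s t"
proof -
  have len: "length s = 2 * n" and "end": "walk_pos s (2 * n) = (0, 0)"
    and q: "\<And>t. t \<le> 2 * n \<Longrightarrow> 0 \<le> fst (walk_pos s t) \<and> 0 \<le> snd (walk_pos s t)"
    using s by (auto simp: quadrant_walks_def in_first_quadrant_def)
  have step: "walk_pos s (Suc t) - walk_pos s t \<in> {step_e, step_w, step_se, step_nw}"
    if "t < 2 * n" for t
    using walk_step_cases[OF s that] step_eq[of t s] len that by simp
  have low: "lower_height s (Suc t) = lower_height s t + 1 \<or> lower_height s (Suc t) = lower_height s t - 1"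
    if "t < 2 * n" for t
    using step[OF that] unfolding lower_height_def
    by (cases "walk_pos s t"; cases "walk_pos s (Suc t)") auto
  have up: "upper_height s (Suc t) = upper_height s t + 1 \<or> upper_height s (Suc t) = upper_height s t - 1"
    if "t < 2 * n" for t
    using step[OF that] unfolding upper_height_def
    by (cases "walk_pos s t"; cases "walk_pos s (Suc t)") auto
  show "dyck_height n (lower_height s)"
    unfolding dyck_height_def using low q "end" by (auto simp: lower_height_def walk_pos_0)
  show "dyck_height n (upper_height s)"
    unfolding dyck_height_def using up q "end" by (auto simp: upper_height_def walk_pos_0)
  show "lower_height s t \<le> upper_height s t" if "t \<le> 2 * n" for t
    using q[OF that] by (simp add: lower_height_def upper_height_def)
qed

lemma has_we_on_x_axis_iff:
  assumes "length s = 2 * n"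
  shows "has_we_on_x_axis s \<longleftrightarrow> common_valley n (lower_height s) (upper_height s)"
proof -
  have "s ! k = step_w \<and> s ! Suc k = step_e \<and> snd (walk_pos s k) = 0 \<longleftrightarrow>
      lower_height s k = upper_height s k \<and> lower_height s (Suc k) = upper_height s (Suc k) \<and>
      lower_height s (Suc (Suc k)) = upper_height s (Suc (Suc k)) \<and>
      lower_height s (Suc k) = lower_height s k - 1 \<and>
      lower_height s (Suc (Suc k)) = lower_height s k"
    if k: "Suc k < 2 * n" for k
    using k assms step_eq[of k s] step_eq[of "Suc k" s] unfolding lower_height_def upper_height_def
    by (cases "walk_pos s k"; cases "walk_pos s (Suc k)"; cases "walk_pos s (Suc (Suc k))") auto
  then show ?thesis
    unfolding has_we_on_x_axis_def common_valley_def assms by blast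
qed

lemma walk_eqI:
  assumes "length s = m" "length s' = m" "\<And>t. t \<le> m \<Longrightarrow> walk_pos s t = walk_pos s' t"
  shows "s = s'"
proof (rule nth_equalityI)
  show "length s = length s'" using assms by simp
  show "s ! k = s' ! k" if "k < length s" for k
    using that assms step_eq[of k s] step_eq[of k s'] by simp
qed

lemma ex_walk_with_heights:
  assumes l: "dyck_height n l" and u: "dyck_height n u"
    and lu: "\<And>t. t \<le> 2 * n \<Longrightarrow> l t \<le> u t" and nv: "\<not> common_valley n l u"
  shows "\<exists>s\<in>quadrant_walks (2 * n). \<forall>t\<le>2 * n. lower_height s t = l t \<and> upper_height s t = u t"
proof -
  define y where "y t = (u t - l t) div 2" for t
  have y: "u t = l t + 2 * y t" if "t \<le> 2 * n" for t
    using dyck_height_parity[OF l that] dyck_height_parity[OF u that] unfolding y_def by presburger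
  define s where "s = map (\<lambda>t. (l (Suc t) - l t, y (Suc t) - y t)) [0..<2 * n]"
  have len: "length s = 2 * n" by (simp add: s_def)
  have pos: "walk_pos s t = (l t, y t)" if "t \<le> 2 * n" for t
    using that
  proof (induction t)
    case 0
    show ?case using l u by (simp add: walk_pos_0 y_def dyck_height_def)
  next
    case (Suc t)
    then show ?case by (simp add: walk_pos_Suc len) (simp add: s_def)
  qed
  have h: "lower_height s t = l t" "upper_height s t = u t" if "t \<le> 2 * n" for t
    using pos[OF that] y[OF that] by (simp_all add: lower_height_def upper_height_def)
  have "s ! t \<in> {step_e, step_w, step_se, step_nw}" if t: "t < 2 * n" for t
    using dyck_height_step[OF l t] dyck_height_step[OF u t] y[of t] y[of "Suc t"] t
    by (auto simp: s_def)
  then have "set s \<subseteq> {step_e, step_w, step_se, step_nw}"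
    by (metis len in_set_conv_nth subsetI)
  moreover have "in_first_quadrant s"
    unfolding in_first_quadrant_def len
    using pos y lu dyck_height_nonneg[OF l] by force
  moreover have "walk_pos s (2 * n) = (0, 0)"
    using pos[of "2 * n"] l u by (simp add: y_def dyck_height_def)
  moreover have "\<not> has_we_on_x_axis s"
  proof -
    have "common_valley n (lower_height s) (upper_height s) \<longleftrightarrow> common_valley n l u"
      unfolding common_valley_def by (rule iff_exI) (simp add: h cong: conj_cong)
    then show ?thesis using nv has_we_on_x_axis_iff[OF len] by simp
  qed
  ultimately have "s \<in> quadrant_walks (2 * n)" using len by (simp add: quadrant_walks_def)
  then show ?thesis using h by blast
qed

section \<open>The bijection\<close>

definition between_paths :: "nat \<Rightarrow> (int \<times> int) list \<Rightarrow> nat set set" where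
  "between_paths n s = below n (upper_height s) - below n (lower_height s)"

lemma between_paths_interval_closed:
  assumes n: "n \<ge> 1" and s: "s \<in> quadrant_walks (2 * n)"
  shows "between_paths n s \<in> interval_closed_sets (root_poset_A (n - 1))"
proof -
  note h = quadrant_walk_heights[OF s]
  have "z \<in> between_paths n s"
    if "a \<in> between_paths n s" "b \<in> between_paths n s" "z \<in> root_poset_A (n - 1)" "a \<subseteq> z" "z \<subseteq> b"
    for a b z
  proof -
    have "a \<in> root_poset_A (n - 1)"
      using that(1) below_subset[OF n] unfolding between_paths_def by blast
    then show ?thesis
      using that below_down_closed[OF h(1) _ _ n, of z a] below_down_closed[OF h(2) _ _ n, of b z]
      unfolding between_paths_def by blast
  qed
  moreover have "between_paths n s \<subseteq> root_poset_A (n - 1)"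
    using below_subset[OF n] unfolding between_paths_def by blast
  ultimately show ?thesis
    unfolding interval_closed_sets_def less_le by blast
qed

text \<open>The lower ideal of a walk is recovered from the difference as the set of the roots that lie
  weakly above none of its elements, the upper ideal as the union of the two.\<close>

lemma between_paths_inj:
  assumes n: "n \<ge> 1"
  shows "inj_on (between_paths n) (quadrant_walks (2 * n))"
proof (rule inj_onI)
  fix s s' assume s: "s \<in> quadrant_walks (2 * n)" and s': "s' \<in> quadrant_walks (2 * n)"
    and eq: "between_paths n s = between_paths n s'"
  have lower: "below n (lower_height r) = not_above n (between_paths n r)"
    and upper: "below n (upper_height r) = not_above n (between_paths n r) \<union> between_paths n r"
    if r: "r \<in> quadrant_walks (2 * n)" for r
  proof -
    note h = quadrant_walk_heights[OF r]
    have "\<not> common_valley n (lower_height r) (upper_height r)"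
      using r has_we_on_x_axis_iff[of r n] by (simp add: quadrant_walks_def)
    then show *: "below n (lower_height r) = not_above n (between_paths n r)"
      using no_common_valley_iff[OF n h] by (simp add: between_paths_def)
    have "z \<in> below n (upper_height r)" if z: "z \<in> below n (lower_height r)" for z
    proof -
      obtain i j where "z = {i..j}" "1 \<le> i" "i \<le> j" "j < n" "int j - int i < lower_height r (i + j)"
        using z by (auto simp: below_def)
      then show ?thesis using h(3)[of "i + j"] by (simp add: atLeastAtMost_mem_below_iff)
    qed
    then show "below n (upper_height r) = not_above n (between_paths n r) \<union> between_paths n r"
      using * unfolding between_paths_def by blast
  qed
  note h = quadrant_walk_heights[OF s] and h' = quadrant_walk_heights[OF s']
  have L: "below n (lower_height s) = below n (lower_height s')"
    and U: "below n (upper_height s) = below n (upper_height s')"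
    using lower upper s s' eq by simp_all
  have "walk_pos s t = walk_pos s' t" if t: "t \<le> 2 * n" for t
  proof -
    have "lower_height s t = lower_height s' t"
      using below_mono_imp_le[OF h(1) h'(1) _ t] below_mono_imp_le[OF h'(1) h(1) _ t] L by force
    moreover have "upper_height s t = upper_height s' t"
      using below_mono_imp_le[OF h(2) h'(2) _ t] below_mono_imp_le[OF h'(2) h(2) _ t] U by force
    ultimately show ?thesis
      by (simp add: lower_height_def upper_height_def prod_eq_iff)
  qed
  then show "s = s'"
    using walk_eqI[of s "2 * n" s'] s s' by (simp add: quadrant_walks_def)
qed

lemma between_paths_surj:
  assumes n: "n \<ge> 1" and I: "I \<in> interval_closed_sets (root_poset_A (n - 1))"
  shows "\<exists>s\<in>quadrant_walks (2 * n). between_paths n s = I"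
proof -
  obtain l u where lu: "dyck_height n l" "dyck_height n u" "\<forall>t\<le>2 * n. l t \<le> u t"
    "\<not> common_valley n l u" "below n u - below n l = I"
    using interval_closed_ex_paths[OF n I] by blast
  obtain s where s: "s \<in> quadrant_walks (2 * n)"
    "\<forall>t\<le>2 * n. lower_height s t = l t \<and> upper_height s t = u t"
    using ex_walk_with_heights[OF lu(1,2) _ lu(4)] lu(3) by blast
  have "below n g = below n h" if "\<forall>t\<le>2 * n. g t = h t" for g h
  proof -
    have "1 \<le> i \<and> i \<le> j \<and> j < n \<and> int j - int i < g (i + j) \<longleftrightarrow>
        1 \<le> i \<and> i \<le> j \<and> j < n \<and> int j - int i < h (i + j)" for i j
      using that by auto
    then show ?thesis unfolding below_def by simp
  qed
  then have "below n (lower_height s) = below n l" "below n (upper_height s) = below n u"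
    using s(2) by blast+
  then have "between_paths n s = I" using lu(5) by (simp add: between_paths_def)
  then show ?thesis using s(1) by blast
qed

theorem theorem4p1:
  fixes n :: nat
  assumes "n \<ge> 1"
  shows "\<exists>f. bij_betw f (interval_closed_sets (root_poset_A (n - 1))) (quadrant_walks (2 * n))"
proof -
  have "between_paths n ` quadrant_walks (2 * n) = interval_closed_sets (root_poset_A (n - 1))"
    using between_paths_interval_closed[OF assms] between_paths_surj[OF assms] by blast
  then have "bij_betw (between_paths n) (quadrant_walks (2 * n))
      (interval_closed_sets (root_poset_A (n - 1)))"
    using between_paths_inj[OF assms] by (simp add: bij_betw_def)
  then show ?thesis using bij_betw_inv_into by blast
qed

end
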